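(* Let $X\sim\mathrm{Unif}[0,1]$, let $\beta_1^\star\neq\beta_2^\star$ be vectors in $\mathbb{R}^J$, let $\alpha^\star:[0,1]\to[0,1]$ be nondecreasing, and let $$w^\star(x)=\alpha^\star(x)\beta_1^\star+(1-\alpha^\star(x))\beta_2^\star .$$ Suppose there exist an interval $[a,b]\subset[0,1]$ and $\kappa>0$ such that $$\alpha^\star(t)-\alpha^\star(s)\ge\kappa(t-s)\qquad\text{for all } a\le s<t\le b .$$ For an integer $M\ge1$, let $\mathcal{W}^{\mathrm{hard}}_M$ be the set of functions $w:[0,1]\to\mathbb{R}^J$ that are constant on each cell of some partition of $[0,1]$ into at most $M$ intervals. Then $$\inf_{w\in\mathcal{W}^{\mathrm{hard}}_M}\mathbb{E}\left[\|w^\star(X)-w(X)\|_2^2\right]\ge\frac{\|\beta_1^\star-\beta_2^\star\|_2^2\,\kappa^2\,(b-a)^3}{12M^2}.$$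
   Context: The partition into at most $M$ intervals may depend on the function $w\in\mathcal{W}^{\mathrm{hard}}_M$. *)

theory Defs
  imports "HOL-Probability.Probability"
begin

text \<open>
  Functions on \<open>[0,1]\<close> are represented as extensional functions, so values outside \<open>[0,1]\<close>,
  which the uniform law does not see, cannot affect measurability.  Cells may be open, closed,
  half-open or single points, and the partition may depend on the function.
\<close>

definition W_hard :: "nat \<Rightarrow> (real \<Rightarrow> real ^ 'J::finite) set" where
  "W_hard m = {w \<in> {0..1} \<rightarrow>\<^sub>E UNIV.
     \<exists>\<P>. partition_on {0..1} \<P> \<and> finite \<P> \<and> card \<P> \<le> m \<and>
         (\<forall>I\<in>\<P>. is_interval I \<and> w constant_on I)}"

end

theory Submission
  imports Defs
begin

text \<open>
  On a cell with end points \<open>p \<le> q\<close>, pair \<open>x\<close> with its reflection \<open>p + q - x\<close>: whatever the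
  constant \<open>c\<close>, the two squared errors add up to at least half the squared distance of the two
  values of \<open>w\<^sup>*\<close>, that is, to at least \<open>K\<^sup>2 (2x - p - q)\<^sup>2 / 2\<close> with \<open>K = \<kappa> \<parallel>\<beta>1 - \<beta>2\<parallel>\<close>.  Integrating,
  a cell of length \<open>l\<close> contributes at least \<open>K\<^sup>2 l\<^sup>3 / 12\<close>, and by convexity the sum of \<open>l\<^sup>3\<close> over at
  most \<open>m\<close> cells covering \<open>[a, b]\<close> is at least \<open>(b - a)\<^sup>3 / m\<^sup>2\<close>.
\<close>

section \<open>Intervals in a segment and measurability of step functions\<close>

text \<open>Take \<open>p = Inf J\<close> and \<open>q = Sup J\<close>; an empty \<open>J\<close> is
  treated apart with \<open>p = q = a\<close>. Squeezing \<open>J\<close> between an open and a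
  closed interval handles open, closed, half-open and one-point cells alike.\<close>

lemma bounded_interval_between:
  fixes J :: "real set"
  assumes "is_interval J" "J \<subseteq> {a..b}" "a \<le> b"
  obtains p q where "a \<le> p" "p \<le> q" "q \<le> b" "{p<..<q} \<subseteq> J" "J \<subseteq> {p..q}"
proof (cases "J = {}")
  case True
  then show ?thesis using that[of a a] assms(3) by auto
next
  case False
  have bdd: "bdd_below J" "bdd_above J"
    using assms(2) by (auto intro: bdd_below_mono bdd_above_mono)
  have sub: "J \<subseteq> {Inf J..Sup J}"
    using bdd by (auto intro: cInf_lower cSup_upper)
  have "{Inf J<..<Sup J} \<subseteq> J"
  proof
    fix x assume "x \<in> {Inf J<..<Sup J}"
    then obtain s t where "s \<in> J" "s < x" "t \<in> J" "x < t"
      using False bdd by (auto simp: cInf_less_iff less_cSup_iff)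
    then show "x \<in> J"
      using assms(1) by (meson is_interval_1 less_imp_le)
  qed
  moreover have "a \<le> Inf J" "Sup J \<le> b"
    using False assms(2) by (auto intro!: cInf_greatest cSup_least)
  moreover have "Inf J \<le> Sup J"
    using False sub by auto
  ultimately show ?thesis using that sub by blast
qed

lemma bounded_interval_borel:
  fixes J :: "real set"
  assumes "is_interval J" "J \<subseteq> {a..b}"
  shows "J \<in> sets borel"
proof (cases "a \<le> b")
  case True
  then obtain p q where pq: "{p<..<q} \<subseteq> J" "J \<subseteq> {p..q}"
    using bounded_interval_between[OF assms] by metis
  have "finite (J \<inter> {p, q})" by simp
  moreover have "J = {p<..<q} \<union> (J \<inter> {p, q})"
    using pq by force
  ultimately show ?thesis
    by (metis borel_open open_greaterThanLessThan sets.Un finite_imp_closed borel_closed)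
next
  case False
  then show ?thesis using assms(2) by simp
qed

text \<open>The cells and the complement of \<open>{a..b}\<close> form a finite Borel cover of the
  line. On each piece \<open>w\<close> is constant, the value on the complement being
  \<open>undefined\<close> by extensionality.\<close>

lemma borel_measurable_piecewise_constant:
  fixes w :: "real \<Rightarrow> 'b::topological_space"
  assumes w: "w \<in> extensional {a..b}"
    and P: "partition_on {a..b} \<P>" "finite \<P>"
    and cell: "\<And>I. I \<in> \<P> \<Longrightarrow> is_interval I \<and> w constant_on I"
  shows "w \<in> borel_measurable borel"
proof (rule measurable_piecewise_restrict[where C = "insert (- {a..b}) \<P>"])
  show "countable (insert (- {a..b}) \<P>)"
    using P(2) by (simp add: countable_finite)
  show "space borel \<subseteq> \<Union> (insert (- {a..b}) \<P>)"
    using P(1) by (auto simp: partition_on_def)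
  fix I assume I: "I \<in> insert (- {a..b}) \<P>"
  show "I \<inter> space borel \<in> sets borel"
  proof (cases "I = - {a..b}")
    case False
    with I P(1) have "I \<subseteq> {a..b}" by (auto simp: partition_on_def)
    then show ?thesis using I False cell bounded_interval_borel[of I a b] by auto
  qed simp
  obtain c where "\<And>x. x \<in> I \<Longrightarrow> w x = c"
  proof (cases "I = - {a..b}")
    case True
    then show ?thesis using that[of undefined] w by (auto simp: extensional_def)
  next
    case False
    with I cell have "w constant_on I" by blast
    then show ?thesis using that by (auto simp: constant_on_def)
  qed
  then show "w \<in> borel_measurable (restrict_space borel I)"
    by (subst measurable_cong[where g = "\<lambda>_. c"]) (auto simp: space_restrict_space)
qed

section \<open>The error on a single cell\<close>

lemma LBINT_square_reflection_distance:
  fixes p q :: real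
  assumes "p \<le> q"
  shows "set_integrable lborel {p<..<q} (\<lambda>x. (2 * x - p - q)\<^sup>2)"
    and "(LBINT x:{p<..<q}. (2 * x - p - q)\<^sup>2) = (q - p) ^ 3 / 3"
proof -
  have cont: "continuous_on {p..q} (\<lambda>x. (2 * x - p - q)\<^sup>2)"
    by (intro continuous_intros)
  show "set_integrable lborel {p<..<q} (\<lambda>x. (2 * x - p - q)\<^sup>2)"
    by (rule set_integrable_subset[OF borel_integrable_atLeastAtMost'[OF cont]]) auto
  have "(LBINT x:{p<..<q}. (2 * x - p - q)\<^sup>2) = (LBINT x=p..q. (2 * x - p - q)\<^sup>2)"
    using assms by (simp add: interval_lebesgue_integral_def einterval_eq)
  \<comment> \<open>The antiderivative is \<open>(2 * x - p - q) ^ 3 / 6\<close>.\<close>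
  also have "\<dots> = (2 * q - p - q) ^ 3 / 6 - (2 * p - p - q) ^ 3 / 6"
    using assms
    by (intro interval_integral_FTC_finite)
      (auto intro!: continuous_intros derivative_eq_intros
        simp: has_real_derivative_iff_has_vector_derivative[symmetric] power2_eq_square)
  also have "\<dots> = (q - p) ^ 3 / 3"
    by (simp add: power3_eq_cube field_simps)
  finally show "(LBINT x:{p<..<q}. (2 * x - p - q)\<^sup>2) = (q - p) ^ 3 / 3" .
qed

text \<open>The substitution \<open>x\<close> to \<open>p + q - x\<close> maps the open interval
  onto itself and has slope -1, hence preserves Lebesgue measure.\<close>

lemma set_lborel_reflect_Ioo:
  fixes g :: "real \<Rightarrow> real"
  assumes "set_integrable lborel {p<..<q} g"
  shows "set_integrable lborel {p<..<q} (\<lambda>x. g (p + q - x))"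
    and "(LBINT x:{p<..<q}. g (p + q - x)) = (LBINT x:{p<..<q}. g x)"
proof -
  have ind: "indicat_real {p<..<q} (p + q - x) = indicat_real {p<..<q} x" for x
    by (auto simp: indicator_def)
  show "set_integrable lborel {p<..<q} (\<lambda>x. g (p + q - x))"
    using lborel_integrable_real_affine[OF assms[unfolded set_integrable_def], of "-1" "p + q"]
    by (simp add: set_integrable_def ind)
  show "(LBINT x:{p<..<q}. g (p + q - x)) = (LBINT x:{p<..<q}. g x)"
    unfolding set_lebesgue_integral_def
    by (subst (2) lborel_integral_real_affine[where c = "-1" and t = "p + q"]) (simp_all add: ind)
qed

lemma norm_diff_square_le:
  fixes u v :: "'b::real_normed_vector"
  shows "(norm (u - v))\<^sup>2 \<le> 2 * ((norm u)\<^sup>2 + (norm v)\<^sup>2)"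
proof -
  have "(norm (u - v))\<^sup>2 \<le> (norm u + norm v)\<^sup>2"
    by (intro power_mono norm_triangle_ineq4) simp
  also have "\<dots> \<le> 2 * ((norm u)\<^sup>2 + (norm v)\<^sup>2)"
    \<comment> \<open>The gap between the two sides is
      \<open>(norm u - norm v)\<^sup>2\<close>.\<close>
    using sum_squares_ge_zero[of "norm u - norm v" 0] by (simp add: power2_eq_square algebra_simps)
  finally show ?thesis .
qed

lemma constant_approximation_error:
  fixes h :: "real \<Rightarrow> 'b::real_normed_vector"
  assumes "p \<le> q" "0 \<le> K"
    and int: "set_integrable lborel {p<..<q} (\<lambda>x. (norm (h x - c))\<^sup>2)"
    and growth: "\<And>s t. p < s \<Longrightarrow> s < t \<Longrightarrow> t < q \<Longrightarrow> K * (t - s) \<le> norm (h t - h s)"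
  shows "K\<^sup>2 * (q - p) ^ 3 / 12 \<le> (LBINT x:{p<..<q}. (norm (h x - c))\<^sup>2)"
proof -
  let ?g = "\<lambda>x. (norm (h x - c))\<^sup>2"
  have growth': "K * \<bar>t - s\<bar> \<le> norm (h t - h s)" if "s \<in> {p<..<q}" "t \<in> {p<..<q}" for s t
    using growth[of s t] growth[of t s] that
    by (cases s t rule: linorder_cases) (auto simp: norm_minus_commute)
  have pt: "K\<^sup>2 / 2 * (2 * x - p - q)\<^sup>2 \<le> ?g x + ?g (p + q - x)" if "x \<in> {p<..<q}" for x
  proof -
    have "K * \<bar>2 * x - p - q\<bar> \<le> norm (h x - h (p + q - x))"
      using growth'[of "p + q - x" x] that by (simp add: algebra_simps)
    then have "(K * \<bar>2 * x - p - q\<bar>)\<^sup>2 \<le> (norm (h x - h (p + q - x)))\<^sup>2"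
      using \<open>0 \<le> K\<close> by (intro power_mono) auto
    \<comment> \<open>The constant \<open>c\<close> cancels in the difference of the two errors, so
      the bound is uniform in \<open>c\<close>.\<close>
    also have "\<dots> \<le> 2 * (?g x + ?g (p + q - x))"
      using norm_diff_square_le[of "h x - c" "h (p + q - x) - c"] by simp
    finally show ?thesis by (simp add: power_mult_distrib)
  qed
  note refl = set_lborel_reflect_Ioo[OF int]
  have "K\<^sup>2 / 2 * ((q - p) ^ 3 / 3) = (LBINT x:{p<..<q}. K\<^sup>2 / 2 * (2 * x - p - q)\<^sup>2)"
    using LBINT_square_reflection_distance(2)[OF \<open>p \<le> q\<close>] by simp
  also have "\<dots> \<le> (LBINT x:{p<..<q}. ?g x + ?g (p + q - x))"
    using pt LBINT_square_reflection_distance(1)[OF \<open>p \<le> q\<close>]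
    by (intro set_integral_mono set_integral_add(1) int refl(1) set_integrable_mult_right) auto
  \<comment> \<open>Both summands have the same integral by reflection. The factors 1/2 (pointwise
    bound), 1/3 (integral) and 1/2 (this doubling) give the constant 1/12.\<close>
  also have "\<dots> = 2 * (LBINT x:{p<..<q}. ?g x)"
    using set_integral_add(2)[OF int refl(1)] refl(2) by simp
  finally show ?thesis by simp
qed

section \<open>Convexity and summation over the cells\<close>

lemma sum_cubes_ge:
  fixes l :: "'i \<Rightarrow> real"
  assumes "card A \<le> m" "1 \<le> m" and l: "\<And>i. i \<in> A \<Longrightarrow> 0 \<le> l i"
  shows "(sum l A) ^ 3 / (real m)\<^sup>2 \<le> (\<Sum>i\<in>A. l i ^ 3)"
proof -
  \<comment> \<open>Dividing by \<open>m\<close> rather than by \<open>card A\<close> yields the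
    bound with \<open>m\<close> directly, even if there are fewer than \<open>m\<close>
    summands.\<close>
  define S t where "S = sum l A" and "t = S / m"
  have "0 \<le> t" using l by (simp add: t_def S_def sum_nonneg)
  \<comment> \<open>The graph of \<open>x \<mapsto> x\<^sup>3\<close> lies above its tangent at the average \<open>t\<close>.\<close>
  have tangent: "3 * t\<^sup>2 * x - 2 * t ^ 3 \<le> x ^ 3" if "0 \<le> x" for x
  proof -
    have "x ^ 3 - (3 * t\<^sup>2 * x - 2 * t ^ 3) = (x - t)\<^sup>2 * (x + 2 * t)"
      by (simp add: power2_eq_square power3_eq_cube algebra_simps)
    moreover have "0 \<le> (x - t)\<^sup>2 * (x + 2 * t)"
      using that \<open>0 \<le> t\<close> by simp
    ultimately show ?thesis by linarith
  qed
  have "S ^ 3 / (real m)\<^sup>2 = 3 * t\<^sup>2 * S - m * (2 * t ^ 3)"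
    using \<open>1 \<le> m\<close> by (simp add: t_def power2_eq_square power3_eq_cube field_simps)
  \<comment> \<open>Each summand contributes \<open>- 2 * t ^ 3\<close>, which is at most 0, so
    having fewer summands can only raise the value.\<close>
  also have "\<dots> \<le> 3 * t\<^sup>2 * S - card A * (2 * t ^ 3)"
    using \<open>card A \<le> m\<close> \<open>0 \<le> t\<close> by (simp add: mult_right_mono)
  also have "\<dots> = (\<Sum>i\<in>A. 3 * t\<^sup>2 * l i - 2 * t ^ 3)"
    by (simp add: S_def sum_subtractf sum_distrib_left)
  also have "\<dots> \<le> (\<Sum>i\<in>A. l i ^ 3)"
    using l tangent by (intro sum_mono) auto
  finally show ?thesis by (simp add: S_def)
qed

text \<open>Cut every cell down to \<open>{a..b}\<close>, where \<open>h\<close> is known to grow,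
  apply the one-cell bound to each piece and combine the cubes of the lengths. Pieces that are empty
  or single points have length 0.\<close>

lemma piecewise_constant_approximation_error:
  fixes h w :: "real \<Rightarrow> 'b::real_normed_vector"
  assumes ab: "A \<le> a" "a \<le> b" "b \<le> B" and "0 \<le> K"
    and P: "partition_on {A..B} \<P>" "finite \<P>" "card \<P> \<le> m" "1 \<le> m"
    and cell: "\<And>I. I \<in> \<P> \<Longrightarrow> is_interval I \<and> w constant_on I"
    and int: "set_integrable lborel {A..B} (\<lambda>x. (norm (h x - w x))\<^sup>2)"
    and growth: "\<And>s t. a \<le> s \<Longrightarrow> s < t \<Longrightarrow> t \<le> b \<Longrightarrow> K * (t - s) \<le> norm (h t - h s)"
  shows "K\<^sup>2 * (b - a) ^ 3 / (12 * (real m)\<^sup>2) \<le> (LBINT x:{A..B}. (norm (h x - w x))\<^sup>2)"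
proof -
  let ?g = "\<lambda>x. (norm (h x - w x))\<^sup>2"
  define J where "J I = I \<inter> {a..b}" for I
  define l where "l I = measure lborel (J I)" for I
  have int': "set_integrable lborel S ?g" if "S \<in> sets borel" "S \<subseteq> {A..B}" for S
    using set_integrable_subset[OF int] that by simp
  \<comment> \<open>The integrand is nonnegative, so enlarging the domain cannot decrease the
    integral.\<close>
  have mono: "(LBINT x:S. ?g x) \<le> (LBINT x:T. ?g x)"
    if "S \<subseteq> T" "S \<in> sets borel" "T \<in> sets borel" "T \<subseteq> {A..B}" for S T
    unfolding set_lebesgue_integral_def
    using int'[of S] int'[of T] that
    by (intro integral_mono) (auto simp: set_integrable_def indicator_def)
  have J_int: "is_interval (J I)" if "I \<in> \<P>" for I
    using cell[OF that] is_interval_cc[of a b] by (auto simp: J_def intro: is_interval_Int)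
  have J_sub: "J I \<subseteq> {a..b}" for I
    by (simp add: J_def)
  have J_borel: "J I \<in> sets borel" if "I \<in> \<P>" for I
    using bounded_interval_borel[OF J_int[OF that] J_sub] .
  have J_Un: "(\<Union>I\<in>\<P>. J I) = {a..b}"
    using P(1) ab by (force simp: partition_on_def J_def)
  have J_disj: "disjoint_family_on J \<P>"
    using P(1) by (auto simp: partition_on_def disjoint_def disjoint_family_on_def J_def)
  have on_cell: "K\<^sup>2 / 12 * l I ^ 3 \<le> (LBINT x:J I. ?g x)" if I: "I \<in> \<P>" for I
  proof -
    \<comment> \<open>The end points may or may not lie in \<open>J I\<close>: the closed interval
      bounds its length, while the open one carries the error estimate.\<close>
    obtain p q where pq: "a \<le> p" "p \<le> q" "q \<le> b" "{p<..<q} \<subseteq> J I" "J I \<subseteq> {p..q}"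
      using bounded_interval_between[OF J_int[OF I] J_sub ab(2)] .
    have "l I \<le> q - p"
      using measure_mono_fmeasurable[OF pq(5), of lborel] J_borel[OF I] pq(2) fmeasurable_cbox[of p q]
      by (simp add: l_def)
    then have "K\<^sup>2 / 12 * l I ^ 3 \<le> K\<^sup>2 / 12 * (q - p) ^ 3"
      by (intro mult_left_mono power_mono) (auto simp: l_def)
    also obtain c where c: "\<And>x. x \<in> I \<Longrightarrow> w x = c"
      using cell[OF I] by (auto simp: constant_on_def)
    then have eq: "?g x = (norm (h x - c))\<^sup>2" if "x \<in> {p<..<q}" for x
      using that pq(4) by (auto simp: J_def)
    have "K\<^sup>2 / 12 * (q - p) ^ 3 \<le> (LBINT x:{p<..<q}. (norm (h x - c))\<^sup>2)"
    proof -
      have "set_integrable lborel {p<..<q} ?g"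
        using pq ab by (intro int') auto
      then have "set_integrable lborel {p<..<q} (\<lambda>x. (norm (h x - c))\<^sup>2)"
        using eq by (subst (asm) set_integrable_cong[OF refl refl eq]) auto
      from constant_approximation_error[OF pq(2) \<open>0 \<le> K\<close> this] show ?thesis
        using growth pq(1,3) by simp
    qed
    also have "\<dots> = (LBINT x:{p<..<q}. ?g x)"
      using eq by (intro set_lebesgue_integral_cong) auto
    also have "\<dots> \<le> (LBINT x:J I. ?g x)"
      using pq J_borel[OF I] J_sub[of I] ab by (intro mono) auto
    finally show ?thesis .
  qed
  have suml: "sum l \<P> = b - a"
  proof -
    \<comment> \<open>The real-valued \<open>measure\<close> is additive only when the pieces have
      finite measure.\<close>
    have "emeasure lborel (J I) \<noteq> \<infinity>" if "I \<in> \<P>" for I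
      using fmeasurableI2[OF fmeasurable_cbox, of "J I" a b] J_sub J_borel[OF that]
      by (auto simp: fmeasurable_def)
    then have "measure lborel (\<Union>I\<in>\<P>. J I) = sum l \<P>"
      unfolding l_def using P(2) J_disj J_borel by (intro measure_finite_Union) auto
    then show ?thesis using J_Un ab(2) by simp
  qed
  have "K\<^sup>2 * (b - a) ^ 3 / (12 * (real m)\<^sup>2) = K\<^sup>2 / 12 * ((sum l \<P>) ^ 3 / (real m)\<^sup>2)"
    by (simp add: suml)
  also have "\<dots> \<le> K\<^sup>2 / 12 * (\<Sum>I\<in>\<P>. l I ^ 3)"
    using P by (intro mult_left_mono sum_cubes_ge) (auto simp: l_def)
  also have "\<dots> \<le> (\<Sum>I\<in>\<P>. LBINT x:J I. ?g x)"
    unfolding sum_distrib_left by (intro sum_mono on_cell)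
  also have "\<dots> = (LBINT x:{a..b}. ?g x)"
    unfolding J_Un[symmetric] using P(2) J_disj J_borel J_sub ab
    by (intro set_integral_finite_Union[symmetric] int') fastforce+
  also have "\<dots> \<le> (LBINT x:{A..B}. ?g x)"
    using ab by (intro mono) auto
  finally show ?thesis .
qed

section \<open>The uniform law and the lower bound on the infimum\<close>

lemma integral_uniform_measure_Icc_0_1:
  fixes f :: "real \<Rightarrow> real"
  assumes "f \<in> borel_measurable borel"
  shows "integral\<^sup>L (uniform_measure lborel {0..1}) f = (LBINT x:{0..1}. f x)"
proof -
  \<comment> \<open>The normalising factor is 1 because the unit interval has Lebesgue measure
    1.\<close>
  have "uniform_measure lborel {0..1::real} = density lborel (\<lambda>x. ennreal (indicator {0..1} x))"
    by (simp add: uniform_measure_def divide_ennreal_def flip: ennreal_indicator)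
  then show ?thesis
    using assms by (simp add: integral_density set_lebesgue_integral_def)
qed

theorem corollary1:
  fixes P :: "'a measure" and X :: "'a \<Rightarrow> real"
    and \<beta>1 \<beta>2 :: "real ^ 'J::finite"
    and \<alpha> :: "real \<Rightarrow> real" and wstar :: "real \<Rightarrow> real ^ 'J"
    and a b \<kappa> :: real and m :: nat
  assumes "prob_space P"
    and "X \<in> borel_measurable P"
    and "distr P borel X = uniform_measure lborel {0..1}"
    and "\<beta>1 \<noteq> \<beta>2"
    and "\<alpha> \<in> {0..1} \<rightarrow> {0..1}"
    and "mono_on {0..1} \<alpha>"
    and "wstar = (\<lambda>x\<in>{0..1}. \<alpha> x *\<^sub>R \<beta>1 + (1 - \<alpha> x) *\<^sub>R \<beta>2)"
    and "0 \<le> a" and "a \<le> b" and "b \<le> 1"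
    and "\<kappa> > 0"
    and "\<And>s t. a \<le> s \<Longrightarrow> s < t \<Longrightarrow> t \<le> b \<Longrightarrow> \<alpha> t - \<alpha> s \<ge> \<kappa> * (t - s)"
    and "m \<ge> 1"
  shows "(INF w\<in>W_hard m. prob_space.expectation P (\<lambda>\<omega>. (norm (wstar (X \<omega>) - w (X \<omega>)))\<^sup>2))
           \<ge> (norm (\<beta>1 - \<beta>2))\<^sup>2 * \<kappa>\<^sup>2 * (b - a) ^ 3 / (12 * (real m)\<^sup>2)"
proof (rule cINF_greatest)
  \<comment> \<open>A lower bound for a real infimum requires a nonempty family. The zero function
    on the one-cell partition belongs to it, as \<open>m \<ge> 1\<close>.\<close>
  show "W_hard m \<noteq> ({} :: (real \<Rightarrow> real ^ 'J) set)"
  proof -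
    have "partition_on {0..1::real} {{0..1}}"
      by (simp add: partition_on_def disjoint_def)
    then have "(\<lambda>x\<in>{0..1}. 0) \<in> (W_hard m :: (real \<Rightarrow> real ^ 'J) set)"
      using \<open>m \<ge> 1\<close> by (auto simp: W_hard_def constant_on_def intro!: exI[of _ "{{0..1}}"])
    then show ?thesis by blast
  qed
next
  fix w :: "real \<Rightarrow> real ^ 'J" assume w: "w \<in> W_hard m"
  then obtain \<P> where \<P>: "partition_on {0..1} \<P>" "finite \<P>" "card \<P> \<le> m"
    and cell: "\<And>I. I \<in> \<P> \<Longrightarrow> is_interval I \<and> w constant_on I"
    by (auto simp: W_hard_def)
  let ?g = "\<lambda>x. (norm (wstar x - w x))\<^sup>2"
  \<comment> \<open>This is the growth rate of \<open>wstar\<close> on \<open>{a..b}\<close>, since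
    its increments are those of \<open>\<alpha>\<close> times
    \<open>\<beta>1 - \<beta>2\<close>.\<close>
  define K where "K = norm (\<beta>1 - \<beta>2) * \<kappa>"
  have [measurable]: "w \<in> borel_measurable borel"
    using w \<P> cell by (intro borel_measurable_piecewise_constant) (auto simp: W_hard_def PiE_def)
  \<comment> \<open>Monotonicity makes \<open>\<alpha>\<close> Borel on the unit interval; outside
    it \<open>wstar\<close> is constantly \<open>undefined\<close>.\<close>
  have "\<alpha> \<in> borel_measurable (restrict_space borel {0..1})"
    using assms(6) by (rule borel_measurable_mono_on_fnc)
  then have "(\<lambda>x. \<alpha> x *\<^sub>R \<beta>1 + (1 - \<alpha> x) *\<^sub>R \<beta>2) \<in> borel_measurable (restrict_space borel {0..1})"
    by measurable
  then have [measurable]: "wstar \<in> borel_measurable borel"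
    unfolding assms(7) restrict_def
    by (subst measurable_If_restrict_space_iff) (auto simp: atLeastAtMost_def atLeast_def atMost_def Collect_conj_eq)
  have g[measurable]: "?g \<in> borel_measurable borel"
    by measurable
  \<comment> \<open>Finitely many cells give finitely many values, so \<open>w\<close> is bounded on
    the unit interval.\<close>
  have fin: "finite (w ` {0..1})"
  proof -
    have "finite (w ` I)" if "I \<in> \<P>" for I
      using cell[OF that] by (auto simp: constant_on_def intro: finite_subset[of _ "{_}"])
    moreover have "w ` {0..1} = (\<Union>I\<in>\<P>. w ` I)"
      using \<P>(1) by (auto simp: partition_on_def)
    ultimately show ?thesis using \<P>(2) by simp
  qed
  obtain C where C: "\<And>x. x \<in> {0..1} \<Longrightarrow> norm (w x) \<le> C"
    using finite_imp_bounded[OF fin] unfolding bounded_iff by (metis imageI)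
  have "norm (wstar x) \<le> norm \<beta>1 + norm \<beta>2" if "x \<in> {0..1}" for x
  proof -
    have "\<alpha> x \<in> {0..1}" using assms(5) that by auto
    then have "norm (\<alpha> x *\<^sub>R \<beta>1) \<le> norm \<beta>1" "norm ((1 - \<alpha> x) *\<^sub>R \<beta>2) \<le> norm \<beta>2"
      by (auto intro: mult_left_le_one_le)
    then show ?thesis
      using that norm_triangle_ineq[of "\<alpha> x *\<^sub>R \<beta>1" "(1 - \<alpha> x) *\<^sub>R \<beta>2"] by (simp add: assms(7))
  qed
  then have bound: "norm (?g x) \<le> (norm \<beta>1 + norm \<beta>2 + C)\<^sup>2" if "x \<in> {0..1}" for x
    using that C[OF that] norm_triangle_ineq4[of "wstar x" "w x"]
    by (auto intro!: power_mono) (smt (verit))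
  \<comment> \<open>The Bochner integral of a non-integrable function is 0 by convention, so a
    positive lower bound rests on integrability. It follows here from boundedness on a set of finite
    measure.\<close>
  have int: "set_integrable lborel {0..1} ?g"
    unfolding set_integrable_def
    using bound
    by (intro integrableI_bounded_set_indicator[where B = "(norm \<beta>1 + norm \<beta>2 + C)\<^sup>2"]) auto
  have growth: "K * (t - s) \<le> norm (wstar t - wstar s)" if "a \<le> s" "s < t" "t \<le> b" for s t
  proof -
    have "wstar t - wstar s = (\<alpha> t - \<alpha> s) *\<^sub>R (\<beta>1 - \<beta>2)"
      using that assms(8,10) by (simp add: assms(7) algebra_simps)
    moreover have "\<kappa> * (t - s) \<le> \<bar>\<alpha> t - \<alpha> s\<bar>"
      using assms(12)[OF that] by linarith
    ultimately show ?thesis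
      using mult_right_mono[of "\<kappa> * (t - s)" "\<bar>\<alpha> t - \<alpha> s\<bar>" "norm (\<beta>1 - \<beta>2)"]
      by (simp add: K_def mult_ac)
  qed
  have "K\<^sup>2 * (b - a) ^ 3 / (12 * (real m)\<^sup>2) \<le> (LBINT x:{0..1}. ?g x)"
    using piecewise_constant_approximation_error[OF assms(8-10) _ \<P> assms(13) cell int growth]
      \<open>\<kappa> > 0\<close> by (simp add: K_def)
  also have "\<dots> = integral\<^sup>L (distr P borel X) ?g"
    unfolding assms(3) by (rule integral_uniform_measure_Icc_0_1[OF g, symmetric])
  also have "\<dots> = prob_space.expectation P (\<lambda>\<omega>. ?g (X \<omega>))"
    by (rule integral_distr[OF assms(2) g])
  finally show "(norm (\<beta>1 - \<beta>2))\<^sup>2 * \<kappa>\<^sup>2 * (b - a) ^ 3 / (12 * (real m)\<^sup>2)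
      \<le> prob_space.expectation P (\<lambda>\<omega>. ?g (X \<omega>))"
    by (simp add: K_def power_mult_distrib)
qed

end
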